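(* Let $\mathcal{A}$ be a unital associative algebra over $\mathbb{Q}$, $\mathcal{C}\subseteq\mathcal{A}$ a commutative subalgebra, $\mathcal{I}$ the Lie idealiser of $\mathcal{C}$ in $\mathcal{A}$, and $d\in\mathcal{I}\setminus\mathcal{C}$. Then $\mathfrak{F}=\mathfrak{o}\oplus\mathfrak{e}$ and $$[\mathfrak{e},\mathfrak{e}]\subseteq\mathfrak{o},\qquad [\mathfrak{o},\mathfrak{o}]\subseteq\mathfrak{o},\qquad [\mathfrak{e},\mathfrak{o}]\subseteq\mathfrak{e},\qquad [\mathfrak{o},\mathfrak{e}]\subseteq\mathfrak{e};$$ that is, $\mathfrak{F}$ is a $\mathbb{Z}_2$-graded Lie algebra with degree $0$ component $\mathfrak{o}$ and degree $1$ component $\mathfrak{e}$.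
   Context: The commutator, which is the Lie product, is $[a,b]=a\cdot b-b\cdot a$. The Lie idealiser of $\mathcal{C}$ in $\mathcal{A}$ is $\mathcal{I}=\{d\in\mathcal{A}: [d,\mathcal{C}]\subseteq\mathcal{C}\}$. For $x\in\mathcal{C}$, the fixed $d\in\mathcal{I}\setminus\mathcal{C}$ and an integer $k\ge 0$, $\langle x\rangle_k=\tfrac12(x\cdot d^k+d^k\cdot x)$, with $d^0=1_{\mathcal{A}}$, and $\mathfrak{F}_k$ is the linear space $\{\langle x\rangle_k: x\in\mathcal{C}\}$. The following are defined as direct sums of these linear spaces: $\mathfrak{F}=\bigoplus_{k\ge 0}\mathfrak{F}_k$, $\mathfrak{e}=\bigoplus_{k\ge 0}\mathfrak{F}_{2k}$, $\mathfrak{o}=\bigoplus_{k\ge 0}\mathfrak{F}_{2k+1}$.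
   Formalization: F, e, o are taken as sums of the F_k inside A; F = o + e and the four bracket inclusions are proved for all d, but directness of o ⊕ e and the graded Lie algebra claim are proved when the F_k are independent, without which the defining direct sums need not exist. *)

theory Defs
  imports Complex_Main "HOL-Library.Set_Algebras" "HOL-Library.Z2"
begin

locale rat_algebra = vector_space scale
  for scale :: "rat \<Rightarrow> 'a::ring_1 \<Rightarrow> 'a" +
  assumes scale_mult_left: "scale r x * y = scale r (x * y)"
    and scale_mult_right: "x * scale r y = scale r (x * y)"

text \<open>A subalgebra need not contain the unit of the ambient algebra.\<close>

definition commutative_subalgebra :: "(rat \<Rightarrow> 'a::ring_1 \<Rightarrow> 'a) \<Rightarrow> 'a set \<Rightarrow> bool" where
  "commutative_subalgebra scale C \<longleftrightarrow>
     module.subspace scale C \<and> (\<forall>x\<in>C. \<forall>y\<in>C. x * y \<in> C) \<and> (\<forall>x\<in>C. \<forall>y\<in>C. x * y = y * x)"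

definition commutator :: "'a::ring_1 \<Rightarrow> 'a \<Rightarrow> 'a" where
  "commutator a b = a * b - b * a"

text \<open>For sets \<open>S\<close> and \<open>T\<close>, \<open>[S, T]\<close> is the linear span of the commutators.\<close>

definition commutator_space ::
    "(rat \<Rightarrow> 'a::ring_1 \<Rightarrow> 'a) \<Rightarrow> 'a set \<Rightarrow> 'a set \<Rightarrow> 'a set" where
  "commutator_space scale S T = module.span scale {commutator a b | a b. a \<in> S \<and> b \<in> T}"

definition lie_idealiser :: "'a::ring_1 set \<Rightarrow> 'a set" where
  "lie_idealiser C = {d. \<forall>x\<in>C. commutator d x \<in> C}"

definition sym_term :: "(rat \<Rightarrow> 'a::ring_1 \<Rightarrow> 'a) \<Rightarrow> 'a \<Rightarrow> nat \<Rightarrow> 'a \<Rightarrow> 'a" where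
  "sym_term scale d k x = scale (1 / 2) (x * d ^ k + d ^ k * x)"

definition sym_space :: "(rat \<Rightarrow> 'a::ring_1 \<Rightarrow> 'a) \<Rightarrow> 'a set \<Rightarrow> 'a \<Rightarrow> nat \<Rightarrow> 'a set" where
  "sym_space scale C d k = {sym_term scale d k x | x. x \<in> C}"

text \<open>
  The direct sum of a family of subspaces of an algebra is the internal one: the sum of the
  family (\<open>family_sum\<close>) together with its independence (\<open>independent_family\<close>).
  Independence of the spaces \<open>sym_space scale C d k\<close> is not automatic: for \<open>d\<close> idempotent and
  \<open>C\<close> the scalars, \<open>d\<close> lies in those with \<open>k = 1\<close> and \<open>k = 2\<close>.  The sums below are therefore
  plain sums in the algebra, which are direct exactly when these spaces are independent.
\<close>

definition family_sum :: "('i \<Rightarrow> 'a::comm_monoid_add set) \<Rightarrow> 'a set" where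
  "family_sum V = {\<Sum>i\<in>K. v i | K v. finite K \<and> (\<forall>i\<in>K. v i \<in> V i)}"

definition independent_family :: "('i \<Rightarrow> 'a::comm_monoid_add set) \<Rightarrow> bool" where
  "independent_family V \<longleftrightarrow>
     (\<forall>K v. finite K \<longrightarrow> (\<forall>i\<in>K. v i \<in> V i) \<longrightarrow> (\<Sum>i\<in>K. v i) = 0 \<longrightarrow> (\<forall>i\<in>K. v i = 0))"

definition is_direct_sum ::
    "(rat \<Rightarrow> 'a::ring_1 \<Rightarrow> 'a) \<Rightarrow> 'a set \<Rightarrow> ('i \<Rightarrow> 'a set) \<Rightarrow> bool" where
  "is_direct_sum scale L V \<longleftrightarrow>
     (\<forall>i. module.subspace scale (V i)) \<and> L = family_sum V \<and> independent_family V"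

definition frakF :: "(rat \<Rightarrow> 'a::ring_1 \<Rightarrow> 'a) \<Rightarrow> 'a set \<Rightarrow> 'a \<Rightarrow> 'a set" where
  "frakF scale C d = family_sum (\<lambda>k. sym_space scale C d k)"

definition frak_e :: "(rat \<Rightarrow> 'a::ring_1 \<Rightarrow> 'a) \<Rightarrow> 'a set \<Rightarrow> 'a \<Rightarrow> 'a set" where
  "frak_e scale C d = family_sum (\<lambda>k. sym_space scale C d (2 * k))"

definition frak_o :: "(rat \<Rightarrow> 'a::ring_1 \<Rightarrow> 'a) \<Rightarrow> 'a set \<Rightarrow> 'a \<Rightarrow> 'a set" where
  "frak_o scale C d = family_sum (\<lambda>k. sym_space scale C d (2 * k + 1))"

definition lie_algebra_on ::
    "(rat \<Rightarrow> 'a::ab_group_add \<Rightarrow> 'a) \<Rightarrow> ('a \<Rightarrow> 'a \<Rightarrow> 'a) \<Rightarrow> 'a set \<Rightarrow> bool" where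
  "lie_algebra_on scale br L \<longleftrightarrow>
     module.subspace scale L \<and>
     (\<forall>x\<in>L. \<forall>y\<in>L. br x y \<in> L) \<and>
     (\<forall>x\<in>L. \<forall>y\<in>L. \<forall>z\<in>L. br (x + y) z = br x z + br y z \<and> br x (y + z) = br x y + br x z) \<and>
     (\<forall>r. \<forall>x\<in>L. \<forall>y\<in>L. br (scale r x) y = scale r (br x y) \<and> br x (scale r y) = scale r (br x y)) \<and>
     (\<forall>x\<in>L. br x x = 0) \<and>
     (\<forall>x\<in>L. \<forall>y\<in>L. \<forall>z\<in>L. br x (br y z) + br y (br z x) + br z (br x y) = 0)"

text \<open>The degrees live in the type \<open>bit\<close> of integers modulo 2.\<close>

definition Z2_graded_lie_algebra ::
    "(rat \<Rightarrow> 'a::ring_1 \<Rightarrow> 'a) \<Rightarrow> ('a \<Rightarrow> 'a \<Rightarrow> 'a) \<Rightarrow> 'a set \<Rightarrow> (bit \<Rightarrow> 'a set) \<Rightarrow> bool" where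
  "Z2_graded_lie_algebra scale br L g \<longleftrightarrow>
     lie_algebra_on scale br L \<and> is_direct_sum scale L g \<and>
     (\<forall>i j. \<forall>x\<in>g i. \<forall>y\<in>g j. br x y \<in> g (i + j))"

end

theory Submission
  imports Defs
begin

text \<open>
  Think of the elements \<open>\<Sum> x\<^sub>k d\<^sup>k\<close> with coefficients in \<open>C\<close> as differential operators.  Since
  \<open>[d, C] \<subseteq> C\<close>, the rules \<open>x \<mapsto> x\<close> on \<open>C\<close> and \<open>d \<mapsto> - d\<close> formally define an
  anti-automorphism, the formal adjoint, which multiplies \<open>\<langle>x\<rangle>\<^sub>k\<close> by \<open>(- 1)\<^sup>k\<close>.  So \<open>\<ee>\<close> consists of the
  self-adjoint and \<open>\<oo>\<close> of the anti-self-adjoint operators, and as the adjoint of \<open>[a, b]\<close> is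
  \<open>- [a*, b*]\<close>, all the inclusions follow.  If the \<open>d\<^sup>k\<close> satisfy relations, the adjoint need not be
  well defined as a map; it is therefore replaced by its graph, the relation \<open>adjoint_pair\<close>.
\<close>

section \<open>Sums of families of subspaces\<close>

context vector_space
begin

text \<open>Two finite sums can be added index by index, because each \<open>V i\<close> absorbs the
  sum of its two terms. This makes the library of spans available for family sums.\<close>

lemma family_sum_eq_span:
  assumes V: "\<And>i. subspace (V i)"
  shows "family_sum V = span (\<Union>i. V i)"
proof
  show "family_sum V \<subseteq> span (\<Union>i. V i)"
    unfolding family_sum_def by clarify (rule span_sum, rule span_base, auto)
  show "span (\<Union>i. V i) \<subseteq> family_sum V"
  proof (rule span_minimal)
    show "(\<Union>i. V i) \<subseteq> family_sum V"
    proof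
      fix a assume "a \<in> (\<Union>i. V i)"
      then obtain i where "a \<in> V i" by blast
      then have "a = (\<Sum>j\<in>{i}. a) \<and> finite {i} \<and> (\<forall>j\<in>{i}. a \<in> V j)" by simp
      then show "a \<in> family_sum V"
        unfolding family_sum_def mem_Collect_eq by (intro exI[of _ "{i}"] exI[of _ "\<lambda>_. a"])
    qed
    show "subspace (family_sum V)"
    proof (rule subspaceI)
      show "0 \<in> family_sum V"
        unfolding family_sum_def mem_Collect_eq
        by (intro exI[of _ "{}"] exI[of _ "\<lambda>_. 0"]) simp
    next
      fix a b assume "a \<in> family_sum V" "b \<in> family_sum V"
      then obtain K L v w where
        v: "finite K" "\<forall>i\<in>K. v i \<in> V i" "a = (\<Sum>i\<in>K. v i)" and
        w: "finite L" "\<forall>i\<in>L. w i \<in> V i" "b = (\<Sum>i\<in>L. w i)"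
        unfolding family_sum_def by blast
      \<comment> \<open>Both families are extended by zero, so that their sums run over the common
        index set \<open>K \<union> L\<close>.\<close>
      define u where "u i = (if i \<in> K then v i else 0) + (if i \<in> L then w i else 0)" for i
      have "a = (\<Sum>i\<in>K \<union> L. if i \<in> K then v i else 0)"
        using v w by (auto intro!: sum.mono_neutral_cong_left)
      moreover have "b = (\<Sum>i\<in>K \<union> L. if i \<in> L then w i else 0)"
        using v w by (auto intro!: sum.mono_neutral_cong_left)
      ultimately have "a + b = (\<Sum>i\<in>K \<union> L. u i)"
        by (simp add: u_def sum.distrib)
      moreover have "\<forall>i\<in>K \<union> L. u i \<in> V i"
        using v w V by (auto simp: u_def intro!: subspace_add intro: subspace_0)
      ultimately show "a + b \<in> family_sum V"
        using v(1) w(1) unfolding family_sum_def mem_Collect_eq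
        by (intro exI[of _ "K \<union> L"] exI[of _ u]) simp
    next
      fix r a assume "a \<in> family_sum V"
      then obtain K v where v: "finite K" "\<forall>i\<in>K. v i \<in> V i" "a = (\<Sum>i\<in>K. v i)"
        unfolding family_sum_def by blast
      then have "scale r a = (\<Sum>i\<in>K. scale r (v i)) \<and> (\<forall>i\<in>K. scale r (v i) \<in> V i)"
        using V by (auto simp: scale_sum_right intro: subspace_scale)
      with v(1) show "scale r a \<in> family_sum V"
        unfolding family_sum_def mem_Collect_eq
        by (intro exI[of _ K] exI[of _ "\<lambda>i. scale r (v i)"]) simp
    qed
  qed
qed

lemma subspace_family_sum:
  "(\<And>i. subspace (V i)) \<Longrightarrow> subspace (family_sum V)"
  by (simp add: family_sum_eq_span)

lemma in_family_sum:
  "(\<And>i. subspace (V i)) \<Longrightarrow> a \<in> V i \<Longrightarrow> a \<in> family_sum V"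
  by (auto simp: family_sum_eq_span intro: span_base)

text \<open>The span of a union is the sum of the spans. Here \<open>f\<close> and \<open>g\<close>
  will list the odd and the even indices.\<close>

lemma family_sum_split:
  assumes V: "\<And>i. subspace (V i)" and "range f \<union> range g = UNIV"
  shows "family_sum V = family_sum (\<lambda>i. V (f i)) + family_sum (\<lambda>i. V (g i))"
proof -
  have "(\<Union>i. V i) = (\<Union>i\<in>range f \<union> range g. V i)"
    using assms(2) by simp
  then have "(\<Union>i. V i) = (\<Union>i. V (f i)) \<union> (\<Union>i. V (g i))"
    by (simp add: UN_Un)
  then show ?thesis
    using V by (auto simp: family_sum_eq_span span_Un set_plus_def)
qed

text \<open>A common element has two expansions over disjoint sets of indices; their difference is a
  vanishing sum, so independence kills every summand.\<close>

lemma independent_family_disjoint: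
  assumes V: "\<And>i. subspace (V i)" and ind: "independent_family V"
    and inj: "inj f" "inj g" and disj: "range f \<inter> range g = {}"
  shows "family_sum (\<lambda>i. V (f i)) \<inter> family_sum (\<lambda>i. V (g i)) = {0}"
proof
  show "{0} \<subseteq> family_sum (\<lambda>i. V (f i)) \<inter> family_sum (\<lambda>i. V (g i))"
    using V by (auto intro: subspace_0 subspace_family_sum)
  show "family_sum (\<lambda>i. V (f i)) \<inter> family_sum (\<lambda>i. V (g i)) \<subseteq> {0}"
  proof
    fix a assume "a \<in> family_sum (\<lambda>i. V (f i)) \<inter> family_sum (\<lambda>i. V (g i))"
    then obtain K v L w where
      v: "finite K" "\<forall>i\<in>K. v i \<in> V (f i)" "a = (\<Sum>i\<in>K. v i)" and
      w: "finite L" "\<forall>i\<in>L. w i \<in> V (g i)" "a = (\<Sum>i\<in>L. w i)"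
      unfolding family_sum_def by blast
    \<comment> \<open>This is the family of the relation \<open>a - a = 0\<close>; its values
      outside both ranges never enter the sum.\<close>
    define u where "u j = (if j \<in> range f then v (inv f j) else - w (inv g j))" for j
    have uf: "u (f i) = v i" for i
      using inj by (simp add: u_def)
    have ug: "u (g i) = - w i" for i
      using inj disj by (auto simp: u_def)
    have f: "(\<Sum>j\<in>f ` K. u j) = a"
      using inj by (simp add: sum.reindex inj_on_subset[OF _ subset_UNIV] uf v(3))
    have g: "(\<Sum>j\<in>g ` L. u j) = - a"
      using inj by (simp add: sum.reindex inj_on_subset[OF _ subset_UNIV] ug w(3) sum_negf)
    have "(\<Sum>j\<in>f ` K \<union> g ` L. u j) = (\<Sum>j\<in>f ` K. u j) + (\<Sum>j\<in>g ` L. u j)"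
      using v(1) w(1) disj by (intro sum.union_disjoint) auto
    also have "\<dots> = 0"
      using f g by simp
    finally have "(\<Sum>j\<in>f ` K \<union> g ` L. u j) = 0" .
    moreover have "\<forall>j\<in>f ` K \<union> g ` L. u j \<in> V j"
      using v(2) w(2) V by (auto simp: uf ug intro!: subspace_neg)
    moreover have "finite (f ` K \<union> g ` L)"
      using v(1) w(1) by simp
    ultimately have "\<forall>j\<in>f ` K \<union> g ` L. u j = 0"
      using ind unfolding independent_family_def by blast
    then have "(\<Sum>j\<in>f ` K. u j) = 0"
      by (intro sum.neutral) blast
    then show "a \<in> {0}"
      using f by simp
  qed
qed

end

section \<open>The graph of the formal adjoint\<close>

locale idealiser_element = rat_algebra scale
  for scale :: "rat \<Rightarrow> 'a::ring_1 \<Rightarrow> 'a" +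
  fixes C :: "'a set" and d :: 'a
  assumes comm_C: "commutative_subalgebra scale C"
    and idealiser_d: "d \<in> lie_idealiser C"
begin

abbreviation "S \<equiv> sym_space scale C d"
abbreviation "\<oo> \<equiv> frak_o scale C d"
abbreviation "\<ee> \<equiv> frak_e scale C d"

section \<open>The coefficient algebra and its symmetrised terms\<close>

lemma C_subspace: "subspace C"
  and C_mult: "x \<in> C \<Longrightarrow> y \<in> C \<Longrightarrow> x * y \<in> C"
  and C_commute: "x \<in> C \<Longrightarrow> y \<in> C \<Longrightarrow> x * y = y * x"
  using comm_C by (auto simp: commutative_subalgebra_def)

lemma C_bracket: "x \<in> C \<Longrightarrow> d * x - x * d \<in> C"
  using idealiser_d by (simp add: lie_idealiser_def commutator_def)

lemma sym_term_add: "sym_term scale d k (x + y) = sym_term scale d k x + sym_term scale d k y"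
  by (simp add: sym_term_def algebra_simps)

lemma sym_term_scale: "sym_term scale d k (scale r x) = scale r (sym_term scale d k x)"
  by (simp add: sym_term_def algebra_simps scale_mult_left scale_mult_right)

lemma double_sym_term:
  "x * d ^ k + d ^ k * x = sym_term scale d k x + sym_term scale d k x"
  unfolding sym_term_def scale_left_distrib[symmetric] by simp

lemma subspace_S: "subspace (S k)"
proof (rule subspaceI)
  show "0 \<in> S k"
    using subspace_0[OF C_subspace] by (auto simp: sym_space_def sym_term_def intro!: exI[of _ 0])
next
  fix a b assume "a \<in> S k" "b \<in> S k"
  then show "a + b \<in> S k"
    using subspace_add[OF C_subspace] unfolding sym_space_def
    by (auto simp: sym_term_add[symmetric])
next
  fix r a assume "a \<in> S k"
  then show "scale r a \<in> S k"
    using subspace_scale[OF C_subspace] unfolding sym_space_def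
    by (auto simp: sym_term_scale[symmetric])
qed

lemma subspace_o: "subspace \<oo>" and subspace_e: "subspace \<ee>"
  and subspace_F: "subspace (frakF scale C d)"
  unfolding frak_o_def frak_e_def frakF_def by (intro subspace_family_sum subspace_S)+

lemma sym_term_in_S: "x \<in> C \<Longrightarrow> sym_term scale d k x \<in> S k"
  by (auto simp: sym_space_def)

lemma sym_term_in_e: "x \<in> C \<Longrightarrow> even k \<Longrightarrow> sym_term scale d k x \<in> \<ee>"
  unfolding frak_e_def
  by (auto elim!: evenE intro!: in_family_sum[where V = "\<lambda>k. S (2 * k)"] subspace_S sym_term_in_S)

lemma sym_term_in_o: "x \<in> C \<Longrightarrow> odd k \<Longrightarrow> sym_term scale d k x \<in> \<oo>"
  unfolding frak_o_def
  by (auto elim!: oddE simp del: power_Suc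
      intro!: in_family_sum[where V = "\<lambda>k. S (2 * k + 1)", simplified] subspace_S sym_term_in_S[where k = "Suc _"])

text \<open>The index \<open>n\<close> is a strict bound on the order in \<open>d\<close>, on which
  a later induction runs. Scalars are absorbed into the coefficient \<open>x\<close>.\<close>

inductive adjoint_pair :: "nat \<Rightarrow> 'a \<Rightarrow> 'a \<Rightarrow> bool" for n where
  zero: "adjoint_pair n 0 0"
| gen: "x \<in> C \<Longrightarrow> k < n \<Longrightarrow> adjoint_pair n (x * d ^ k) ((- 1) ^ k * d ^ k * x)"
| add: "adjoint_pair n a a' \<Longrightarrow> adjoint_pair n b b' \<Longrightarrow> adjoint_pair n (a + b) (a' + b')"

lemma adjoint_pair_mono: "adjoint_pair m a a' \<Longrightarrow> m \<le> n \<Longrightarrow> adjoint_pair n a a'"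
  by (induction rule: adjoint_pair.induct) (auto intro: adjoint_pair.intros)

text \<open>On generators the Leibniz rule \<open>d * x = x * d + [d, x]\<close> applies, and
  \<open>[d, x]\<close> is again a coefficient since \<open>d\<close> idealises \<open>C\<close>.
  The order grows by one.\<close>

lemma adjoint_pair_left_d:
  "adjoint_pair n a a' \<Longrightarrow> adjoint_pair (Suc n) (d * a) (- (a' * d))"
proof (induction rule: adjoint_pair.induct)
  case (gen x k)
  have "adjoint_pair (Suc n)
      (x * d ^ Suc k + (d * x - x * d) * d ^ k)
      ((- 1) ^ Suc k * d ^ Suc k * x + (- 1) ^ k * d ^ k * (d * x - x * d))"
    using gen C_bracket by (intro adjoint_pair.intros) auto
  moreover have "x * d ^ Suc k + (d * x - x * d) * d ^ k = d * (x * d ^ k)"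
    by (simp add: algebra_simps)
  moreover have "(- 1) ^ Suc k * d ^ Suc k * x + (- 1) ^ k * d ^ k * (d * x - x * d)
      = - ((- 1) ^ k * d ^ k * x * d)"
    by (simp only: power_Suc2) (simp add: algebra_simps)
  ultimately show ?case by simp
next
  case (add a a' b b')
  from adjoint_pair.add[OF add.IH] show ?case by (simp add: algebra_simps)
qed (simp add: adjoint_pair.zero)

lemma adjoint_pair_left_power:
  "adjoint_pair n a a' \<Longrightarrow> adjoint_pair (k + n) (d ^ k * a) ((- 1) ^ k * (a' * d ^ k))"
proof (induction k)
  case (Suc k)
  have "- ((- 1) ^ k * (a' * d ^ k) * d) = (- 1) ^ Suc k * (a' * d ^ Suc k)"
    by (simp add: mult.assoc power_commutes)
  with adjoint_pair_left_d[OF Suc.IH[OF Suc.prems]] show ?case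
    by (simp add: mult.assoc)
qed simp

text \<open>Commutativity of \<open>C\<close> enters here: it lets \<open>y * x\<close> reappear on
  the adjoint side as \<open>x * y\<close>.\<close>

lemma adjoint_pair_left_C:
  "adjoint_pair n a a' \<Longrightarrow> y \<in> C \<Longrightarrow> adjoint_pair n (y * a) (a' * y)"
proof (induction rule: adjoint_pair.induct)
  case (gen x k)
  then show ?case
    using adjoint_pair.gen[of "y * x" k n] C_mult[of y x] C_commute[of x y]
    by (simp add: mult.assoc)
qed (auto simp: algebra_simps intro: adjoint_pair.intros)

text \<open>This is the rule \<open>(a b)* = b* a*\<close>. A generator \<open>x * d ^ k\<close>
  acts by \<open>k\<close> multiplications by \<open>d\<close> followed by one by \<open>x\<close>,
  so the left multiplication rules suffice.\<close>

lemma adjoint_pair_mult: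
  assumes "adjoint_pair m a a'" "adjoint_pair n b b'"
  shows "adjoint_pair (m + n) (a * b) (b' * a')"
  using assms
proof (induction rule: adjoint_pair.induct)
  case (gen x k)
  have "adjoint_pair (k + n) (x * (d ^ k * b)) ((- 1) ^ k * (b' * d ^ k) * x)"
    using gen by (intro adjoint_pair_left_C adjoint_pair_left_power) auto
  moreover have "(- 1) ^ k * (b' * d ^ k) * x = b' * ((- 1) ^ k * d ^ k * x)"
    by (cases "even k") (simp_all add: mult.assoc)
  ultimately show ?case
    using gen by (auto simp: mult.assoc intro: adjoint_pair_mono)
qed (auto simp: algebra_simps intro: adjoint_pair.intros)

text \<open>The leading terms of \<open>[d ^ n, x]\<close> cancel, leaving order below
  \<open>n\<close>; this drop drives the induction in \<open>adjoint_pair_imp_e_o\<close>.\<close>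

lemma adjoint_pair_bracket_power:
  assumes "x \<in> C"
  shows "adjoint_pair n (d ^ n * x - x * d ^ n) ((- 1) ^ n * (x * d ^ n - d ^ n * x))"
proof (induction n)
  case 0
  then show ?case by (simp add: adjoint_pair.zero)
next
  case (Suc n)
  \<comment> \<open>The recursion is
    \<open>[d ^ Suc n, x] = d * [d ^ n, x] + [d, x] * d ^ n\<close>, with \<open>[d, x]\<close> in
    \<open>C\<close>.\<close>
  have "adjoint_pair (Suc n)
      (d * (d ^ n * x - x * d ^ n) + (d * x - x * d) * d ^ n)
      (- ((- 1) ^ n * (x * d ^ n - d ^ n * x) * d) + (- 1) ^ n * d ^ n * (d * x - x * d))"
    using Suc assms C_bracket
    by (intro adjoint_pair.add adjoint_pair_left_d adjoint_pair.gen) auto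
  moreover have "d * (d ^ n * x - x * d ^ n) + (d * x - x * d) * d ^ n
      = d ^ Suc n * x - x * d ^ Suc n"
    by (simp add: algebra_simps)
  moreover have "- ((- 1) ^ n * (x * d ^ n - d ^ n * x) * d) + (- 1) ^ n * d ^ n * (d * x - x * d)
      = (- 1) ^ Suc n * (x * d ^ Suc n - d ^ Suc n * x)"
    unfolding power_Suc2[of d] by (cases "even n") (simp_all add: algebra_simps)
  ultimately show ?case by simp
qed

section \<open>From adjoint pairs to \<ee> and \<oo>, and back\<close>

lemma in_subspace_if_double: "subspace V \<Longrightarrow> a + a \<in> V \<Longrightarrow> a \<in> V"
  using subspace_scale[of V "a + a" "1 / 2"]
  by (simp add: scale_right_distrib scale_left_distrib[symmetric])

text \<open>For a generator, one of \<open>a + a'\<close> and \<open>a - a'\<close> is twice a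
  symmetrised term of the right parity, and the other is \<open>- [d ^ k, x]\<close>, which has
  lower order and falls to the outer induction on the bound.\<close>

lemma adjoint_pair_imp_e_o:
  "adjoint_pair n a a' \<Longrightarrow> a + a' \<in> \<ee> \<and> a - a' \<in> \<oo>"
proof (induction n arbitrary: a a' rule: less_induct)
  case (less n)
  from less.prems show ?case
  proof (induction rule: adjoint_pair.induct)
    case zero
    then show ?case using subspace_0 subspace_e subspace_o by simp
  next
    case (add a a' b b')
    then have "(a + a') + (b + b') \<in> \<ee>" "(a - a') + (b - b') \<in> \<oo>"
      using subspace_add subspace_e subspace_o by blast+
    then show ?case by (simp add: algebra_simps)
  next
    case (gen x k)
    define T where "T = d ^ k * x - x * d ^ k"
    have minus_T: "x * d ^ k - d ^ k * x = - T"
      by (simp add: T_def)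
    \<comment> \<open>The outer induction hypothesis is used at the smaller bound \<open>k\<close>,
      where \<open>T\<close> is paired with \<open>(- 1) ^ k * (- T)\<close>.\<close>
    have T: "T + (- 1) ^ k * (- T) \<in> \<ee>" "T - (- 1) ^ k * (- T) \<in> \<oo>"
      using less.IH[OF gen(2) adjoint_pair_bracket_power[OF gen(1)]]
      unfolding minus_T T_def[symmetric] by blast+
    show ?case
    proof (cases "even k")
      case True
      \<comment> \<open>For even \<open>k\<close> the partner of \<open>T\<close> is
        \<open>- T\<close>, so their difference is \<open>T + T\<close>; for odd \<open>k\<close>
        the partner is \<open>T\<close> itself, and the sum is used instead.\<close>
      then have "T + T \<in> \<oo>"
        using T by simp
      then have "- T \<in> \<oo>"
        using in_subspace_if_double subspace_neg subspace_o by blast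
      moreover have "x * d ^ k + d ^ k * x \<in> \<ee>"
        unfolding double_sym_term using True gen(1)
        by (intro subspace_add subspace_e sym_term_in_e)
      ultimately show ?thesis
        using True by (simp add: T_def)
    next
      case False
      then have "T + T \<in> \<ee>"
        using T by simp
      then have "- T \<in> \<ee>"
        using in_subspace_if_double subspace_neg subspace_e by blast
      moreover have "x * d ^ k + d ^ k * x \<in> \<oo>"
        unfolding double_sym_term using False gen(1)
        by (intro subspace_add subspace_o sym_term_in_o)
      ultimately show ?thesis
        using False by (simp add: T_def)
    qed
  qed
qed

text \<open>Writing \<open>d ^ k * y = y * d ^ k + [d ^ k, y]\<close> brings the second half of the
  symmetrised term into the reach of the generators.\<close>

lemma adjoint_pair_sym_term:
  assumes "x \<in> C"
  shows "adjoint_pair (Suc k) (sym_term scale d k x) ((- 1) ^ k * sym_term scale d k x)"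
proof -
  \<comment> \<open>The factor one half is moved into the coefficient.\<close>
  define y where "y = scale (1 / 2) x"
  have y: "y \<in> C"
    using assms C_subspace by (simp add: y_def subspace_scale)
  have "adjoint_pair (Suc k)
      (y * d ^ k + (y * d ^ k + (d ^ k * y - y * d ^ k)))
      ((- 1) ^ k * d ^ k * y + ((- 1) ^ k * d ^ k * y + (- 1) ^ k * (y * d ^ k - d ^ k * y)))"
    using y by (intro adjoint_pair.add adjoint_pair.gen
        adjoint_pair_mono[OF adjoint_pair_bracket_power]) auto
  moreover have "sym_term scale d k x = y * d ^ k + d ^ k * y"
    by (simp add: y_def sym_term_def scale_mult_left scale_mult_right scale_right_distrib)
  ultimately show ?thesis
    by (simp add: algebra_simps)
qed

text \<open>All indices \<open>f k\<close> have the same parity, so one sign \<open>s\<close> serves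
  all summands and their pairs can be added.\<close>

lemma adjoint_pair_family_sum:
  assumes "a \<in> family_sum (\<lambda>k. S (f k))" and f: "\<And>k. (- 1) ^ f k = (s :: 'a)"
  shows "\<exists>n. adjoint_pair n a (s * a)"
proof -
  obtain K v where K: "finite K" "\<forall>k\<in>K. v k \<in> S (f k)" "a = (\<Sum>k\<in>K. v k)"
    using assms(1) unfolding family_sum_def by blast
  have "\<exists>n. adjoint_pair n (\<Sum>k\<in>K. v k) (s * (\<Sum>k\<in>K. v k))"
    using K(1,2)
  proof (induction K rule: finite_induct)
    case empty
    then show ?case by (auto intro: adjoint_pair.zero)
  next
    case (insert k K)
    then obtain n where n: "adjoint_pair n (\<Sum>k\<in>K. v k) (s * (\<Sum>k\<in>K. v k))" by auto
    from insert.prems obtain x where x: "x \<in> C" "v k = sym_term scale d (f k) x"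
      by (auto simp: sym_space_def)
    have "adjoint_pair (Suc (f k)) (v k) (s * v k)"
      using adjoint_pair_sym_term[OF x(1), of "f k"] unfolding x(2) f .
    \<comment> \<open>Pairs add only under a common bound, hence the maximum.\<close>
    then have "adjoint_pair (max (Suc (f k)) n) (v k + (\<Sum>k\<in>K. v k)) (s * v k + s * (\<Sum>k\<in>K. v k))"
      by (intro adjoint_pair.add adjoint_pair_mono[OF n])
         (auto intro: adjoint_pair_mono)
    with insert.hyps show ?case by (auto simp: distrib_left)
  qed
  with K(3) show ?thesis by simp
qed

lemma e_self_adjoint: "a \<in> \<ee> \<Longrightarrow> \<exists>n. adjoint_pair n a a"
  using adjoint_pair_family_sum[of a "\<lambda>k. 2 * k" 1] by (simp add: frak_e_def)

lemma o_anti_self_adjoint: "a \<in> \<oo> \<Longrightarrow> \<exists>n. adjoint_pair n a (- a)"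
  using adjoint_pair_family_sum[of a "\<lambda>k. 2 * k + 1" "- 1"] by (simp add: frak_o_def)

section \<open>The grading\<close>

text \<open>With \<open>a' = \<plusminus> a\<close> and \<open>b' = \<plusminus> b\<close>, the
  commutator is \<open>a * b - b' * a'\<close> if the signs agree and \<open>a * b + b' * a'\<close>
  if they differ; the former lies in \<oo>, the latter in \<ee>.\<close>

lemma commutator_mem:
  "a \<in> \<ee> \<Longrightarrow> b \<in> \<ee> \<Longrightarrow> commutator a b \<in> \<oo>"
  "a \<in> \<oo> \<Longrightarrow> b \<in> \<oo> \<Longrightarrow> commutator a b \<in> \<oo>"
  "a \<in> \<ee> \<Longrightarrow> b \<in> \<oo> \<Longrightarrow> commutator a b \<in> \<ee>"
  "a \<in> \<oo> \<Longrightarrow> b \<in> \<ee> \<Longrightarrow> commutator a b \<in> \<ee>"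
proof -
  have mult: "a * b + b' * a' \<in> \<ee>" "a * b - b' * a' \<in> \<oo>"
    if "adjoint_pair m a a'" "adjoint_pair n b b'" for m n a a' b b'
    using adjoint_pair_imp_e_o[OF adjoint_pair_mult[OF that]] by auto
  show "a \<in> \<ee> \<Longrightarrow> b \<in> \<ee> \<Longrightarrow> commutator a b \<in> \<oo>"
    by (auto simp: commutator_def dest!: e_self_adjoint o_anti_self_adjoint
        intro: mult(2)[of _ a a _ b b, simplified])
  show "a \<in> \<oo> \<Longrightarrow> b \<in> \<oo> \<Longrightarrow> commutator a b \<in> \<oo>"
    by (auto simp: commutator_def dest!: e_self_adjoint o_anti_self_adjoint
        intro: mult(2)[of _ a "- a" _ b "- b", simplified])
  show "a \<in> \<ee> \<Longrightarrow> b \<in> \<oo> \<Longrightarrow> commutator a b \<in> \<ee>"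
    by (auto simp: commutator_def dest!: e_self_adjoint o_anti_self_adjoint
        intro: mult(1)[of _ a a _ b "- b", simplified])
  show "a \<in> \<oo> \<Longrightarrow> b \<in> \<ee> \<Longrightarrow> commutator a b \<in> \<ee>"
    by (auto simp: commutator_def dest!: e_self_adjoint o_anti_self_adjoint
        intro: mult(1)[of _ a "- a" _ b b, simplified])
qed

lemma commutator_space_subset:
  assumes "subspace V" "\<And>a b. a \<in> S' \<Longrightarrow> b \<in> T \<Longrightarrow> commutator a b \<in> V"
  shows "commutator_space scale S' T \<subseteq> V"
  unfolding commutator_space_def using assms by (intro span_minimal) auto

lemma F_eq_o_plus_e: "frakF scale C d = \<oo> + \<ee>"
proof -
  have "range (\<lambda>k::nat. 2 * k + 1) \<union> range (\<lambda>k. 2 * k) = UNIV"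
    by (simp add: set_eq_iff image_iff) presburger
  from family_sum_split[OF subspace_S this] show ?thesis
    unfolding frakF_def frak_o_def frak_e_def .
qed

lemma o_inter_e:
  assumes "independent_family S"
  shows "\<oo> \<inter> \<ee> = {0}"
proof -
  have "range (\<lambda>k::nat. 2 * k + 1) \<inter> range (\<lambda>k. 2 * k) = {}"
    by (auto, presburger)
  then show ?thesis
    unfolding frak_o_def frak_e_def
    by (intro independent_family_disjoint[OF subspace_S assms]) (auto simp: inj_def)
qed

section \<open>The Lie algebra and its direct sum decomposition\<close>

lemma commutator_in_F:
  assumes "a \<in> frakF scale C d" "b \<in> frakF scale C d"
  shows "commutator a b \<in> frakF scale C d"
proof -
  obtain p q p' q' where pq: "p \<in> \<oo>" "q \<in> \<ee>" "p' \<in> \<oo>" "q' \<in> \<ee>" "a = p + q" "b = p' + q'"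
    using assms unfolding F_eq_o_plus_e by (auto elim!: set_plus_elim)
  have "commutator a b = (commutator p p' + commutator q q') + (commutator p q' + commutator q p')"
    by (simp add: pq commutator_def algebra_simps)
  also have "\<dots> \<in> \<oo> + \<ee>"
    using pq by (intro set_plus_intro subspace_add subspace_o subspace_e commutator_mem)
  finally show ?thesis unfolding F_eq_o_plus_e .
qed

lemma lie_algebra_F: "lie_algebra_on scale commutator (frakF scale C d)"
  unfolding lie_algebra_on_def using subspace_F commutator_in_F
  by (auto simp: commutator_def algebra_simps scale_mult_left scale_mult_right)

text \<open>Degree 0 goes to \<oo>, the summand closed under the bracket, although its indices are
  the odd ones.\<close>

abbreviation (input) "component i \<equiv> (if i = (0::bit) then \<oo> else \<ee>)"

text \<open>For two subspaces independence amounts to trivial intersection, which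
  \<open>o_inter_e\<close> provides.\<close>

lemma direct_sum_F:
  assumes "independent_family S"
  shows "is_direct_sum scale (frakF scale C d) component"
proof -
  have sub: "subspace (component i)" for i
    by (simp add: subspace_o subspace_e)
  have UNIV_eq: "(UNIV :: bit set) = {0, 1}"
    using bit_not_one_iff by blast
  have "family_sum component = span (\<oo> \<union> \<ee>)"
    unfolding family_sum_eq_span[OF sub] UNIV_eq by (simp add: Un_commute)
  then have F: "frakF scale C d = family_sum component"
    unfolding F_eq_o_plus_e set_plus_def
    by (auto simp: span_Un span_eq_iff[THEN iffD2, OF subspace_o] span_eq_iff[THEN iffD2, OF subspace_e])
  have "independent_family component"
    unfolding independent_family_def
  proof (intro allI impI ballI)
    fix K and v :: "bit \<Rightarrow> 'a" and i
    assume v: "\<forall>i\<in>K. v i \<in> component i" and sum: "(\<Sum>i\<in>K. v i) = 0" and i: "i \<in> K"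
    \<comment> \<open>Extension by zero replaces an arbitrary \<open>K\<close> by both degrees at
      once.\<close>
    define w where "w i = (if i \<in> K then v i else 0)" for i
    have w: "w 0 \<in> \<oo>" "w 1 \<in> \<ee>"
      using v subspace_0 subspace_o subspace_e by (auto simp: w_def)
    have "(\<Sum>i\<in>K. v i) = (\<Sum>i\<in>UNIV. w i)"
      unfolding w_def by (rule sum.mono_neutral_cong_left) (auto simp: UNIV_eq)
    also have "\<dots> = w 0 + w 1"
      by (simp add: UNIV_eq)
    finally have eq: "w 0 = - w 1"
      using sum by (simp add: eq_neg_iff_add_eq_0)
    then have "w 0 \<in> \<oo> \<inter> \<ee>"
      using w subspace_neg[OF subspace_e] by auto
    then have "w 0 = 0" "w 1 = 0"
      using o_inter_e[OF assms] eq by auto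
    then show "v i = 0"
      using i by (cases i) (auto simp: w_def)
  qed
  with sub F show ?thesis
    by (simp add: is_direct_sum_def)
qed

lemma graded_F:
  assumes "independent_family S"
  shows "Z2_graded_lie_algebra scale commutator (frakF scale C d) component"
proof -
  have "commutator x y \<in> component (i + j)" if "x \<in> component i" "y \<in> component j" for i j x y
    using that by (cases i; cases j) (auto intro: commutator_mem)
  with lie_algebra_F direct_sum_F[OF assms] show ?thesis
    unfolding Z2_graded_lie_algebra_def by blast
qed

end

theorem mainTheorem3:
  fixes scale :: "rat \<Rightarrow> 'a::ring_1 \<Rightarrow> 'a" and C :: "'a set" and d :: 'a
  assumes "rat_algebra scale"
    and "commutative_subalgebra scale C"
    and "d \<in> lie_idealiser C - C"
  shows "frakF scale C d = frak_o scale C d + frak_e scale C d \<and>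
    commutator_space scale (frak_e scale C d) (frak_e scale C d) \<subseteq> frak_o scale C d \<and>
    commutator_space scale (frak_o scale C d) (frak_o scale C d) \<subseteq> frak_o scale C d \<and>
    commutator_space scale (frak_e scale C d) (frak_o scale C d) \<subseteq> frak_e scale C d \<and>
    commutator_space scale (frak_o scale C d) (frak_e scale C d) \<subseteq> frak_e scale C d \<and>
    (independent_family (sym_space scale C d) \<longrightarrow>
       frak_o scale C d \<inter> frak_e scale C d = {0} \<and>
       Z2_graded_lie_algebra scale commutator (frakF scale C d)
         (\<lambda>i. if i = 0 then frak_o scale C d else frak_e scale C d))"
proof -
  interpret rat_algebra scale by (fact assms(1))
  interpret idealiser_element scale C d
    using assms(2,3) by unfold_locales auto
  show ?thesis
    using F_eq_o_plus_e o_inter_e graded_F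
    by (intro conjI impI commutator_space_subset subspace_o subspace_e) (auto intro: commutator_mem)
qed

end
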